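(* Let $G$ be a finite group, let $C=(\mathcal{X},\mathcal{K})$ be a supercharacter theory of $G$ with $\mathcal{X}=\{X_1,\ldots,X_m\}$, let $N\unlhd G$ be a $C$-normal subgroup, and let $K$ be a field. Number the $X_i$ so that $X_i\subset\operatorname{Irr}(G/N)$ for $1\leq i\leq p$ and $X_i\not\subset\operatorname{Irr}(G/N)$ for $p+1\leq i\leq m$, and let $\widetilde C=C^{G/N}$ be the induced supercharacter theory of $G/N$. Then $$R_{G/N,\widetilde C}=R_{G,C}\cap K[F_1,\ldots,F_p].$$
   Context: Characters are complex characters of finite groups. A supercharacter theory of a finite group $G$ is a pair $C=(\mathcal{X},\mathcal{K})$, where $\mathcal{X}$ is a partition of $\operatorname{Irr}(G)$ and $\mathcal{K}$ is a partition of $G$ (whose members are called superclasses), such that $\{1\}\in\mathcal{K}$, $|\mathcal{X}|=|\mathcal{K}|$, and for each $X\in\mathcal{X}$ the character $\sigma_X=\sum_{\psi\in X}\psi(1)\psi$ is constant on each superclass. Let $\operatorname{Irr}(G)=\{\chi_1,\ldots,\chi_r\}$, $d_j=\chi_j(1)$, $\operatorname{Ch}(G)=\{\sum_j a_j\chi_j : a_j\in\mathbb{N}\}$, and $\operatorname{Ch}(G,C)=\{a_1\sigma_{X_1}+\cdots+a_m\sigma_{X_m}: a_i\in\mathbb{N}\}\subset\operatorname{Ch}(G)$. $M(G)$ is the submonoid of $\operatorname{Ch}(G)$ generated by the monomial characters, i.e. the induced characters $\lambda^G$ with $\lambda$ a linear (degree one) character of a subgroup of $G$. Put $M(G,C)=\operatorname{Ch}(G,C)\cap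 M(G)$. In $K[x_1,\ldots,x_r]$ let $F_i=\prod_{\chi_j\in X_i}x_j^{d_j}$, $1\leq i\leq m$, and let $R_{G,C}=K[M(G,C)]\subset K[F_1,\ldots,F_m]$ be the $K$-subalgebra spanned by the monomials $F_1^{a_1}\cdots F_m^{a_m}$ with $a_1\sigma_{X_1}+\cdots+a_m\sigma_{X_m}\in M(G,C)$. A normal subgroup $N\unlhd G$ is $C$-normal if it is a union of superclasses of $C$. For $X\in\mathcal{X}$, one writes $X\subset\operatorname{Irr}(G/N)$ if $N\subset\operatorname{Ker}(\chi)$ for all $\chi\in X$; then $\widetilde X\subset\operatorname{Irr}(G/N)$ denotes the set of characters $\widetilde\chi$ of $G/N$ given by $\widetilde\chi(gN)=\chi(g)$, $\chi\in X$. For $N$ $C$-normal, $\widetilde C=C^{G/N}=(\widetilde{\mathcal{X}},\widetilde{\mathcal{K}})$ with $\widetilde{\mathcal{X}}=\{\widetilde{X_1},\ldots,\widetilde{X_p}\}$ and $\widetilde{\mathcal{K}}=\{KN/N : K\in\mathcal{K}\}$ (here $K$ denotes a superclass, not the field); it is known that this is a supercharacter theory of $G/N$. In forming $R_{G/N,\widetilde C}$, the variable attached to $\widetilde\chi_j\in\operatorname{Irr}(G/N)$ is the variable $x_j$ attached to its inflation $\chi_j\in\operatorname{Irr}(G)$, so that the monomial attached to $\widetilde{X_i}$ is $F_i$ and $R_{G/N,\widetilde C}\subset K[F_1,\ldots,F_p]$. *)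

theory Defs
  imports
    "Jordan_Normal_Form.Matrix"
    "HOL-Algebra.Coset"
    "HOL-Library.Poly_Mapping"
    "HOL-Library.Disjoint_Sets"
begin

section \<open>Complex characters of finite groups\<close>

definition is_rep :: "('a, 'b) monoid_scheme \<Rightarrow> nat \<Rightarrow> ('a \<Rightarrow> complex mat) \<Rightarrow> bool" where
  "is_rep G n \<rho> \<longleftrightarrow>
     (\<forall>g\<in>carrier G. \<rho> g \<in> carrier_mat n n) \<and>
     \<rho> \<one>\<^bsub>G\<^esub> = 1\<^sub>m n \<and>
     (\<forall>g\<in>carrier G. \<forall>h\<in>carrier G. \<rho> (g \<otimes>\<^bsub>G\<^esub> h) = \<rho> g * \<rho> h)"

definition invariant_subspace ::
  "('a, 'b) monoid_scheme \<Rightarrow> nat \<Rightarrow> ('a \<Rightarrow> complex mat) \<Rightarrow> complex vec set \<Rightarrow> bool" where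
  "invariant_subspace G n \<rho> W \<longleftrightarrow>
     W \<subseteq> carrier_vec n \<and> 0\<^sub>v n \<in> W \<and>
     (\<forall>u\<in>W. \<forall>w\<in>W. u + w \<in> W) \<and>
     (\<forall>c. \<forall>w\<in>W. c \<cdot>\<^sub>v w \<in> W) \<and>
     (\<forall>g\<in>carrier G. \<forall>w\<in>W. \<rho> g *\<^sub>v w \<in> W)"

definition irreducible_rep :: "('a, 'b) monoid_scheme \<Rightarrow> nat \<Rightarrow> ('a \<Rightarrow> complex mat) \<Rightarrow> bool" where
  "irreducible_rep G n \<rho> \<longleftrightarrow>
     is_rep G n \<rho> \<and> n > 0 \<and>
     (\<forall>W. invariant_subspace G n \<rho> W \<longrightarrow> W = {0\<^sub>v n} \<or> W = carrier_vec n)"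

text \<open>Characters are made extensional by the value 0 off the carrier, so that equality of
  functions is equality of characters.\<close>

definition rep_char :: "('a, 'b) monoid_scheme \<Rightarrow> ('a \<Rightarrow> complex mat) \<Rightarrow> 'a \<Rightarrow> complex" where
  "rep_char G \<rho> = (\<lambda>g. if g \<in> carrier G then \<Sum>i<dim_row (\<rho> g). \<rho> g $$ (i, i) else 0)"

definition Irr :: "('a, 'b) monoid_scheme \<Rightarrow> ('a \<Rightarrow> complex) set" where
  "Irr G = {rep_char G \<rho> | n \<rho>. irreducible_rep G n \<rho>}"

definition linear_chars :: "('a, 'b) monoid_scheme \<Rightarrow> ('a \<Rightarrow> complex) set" where
  "linear_chars G = {rep_char G \<rho> | \<rho>. is_rep G 1 \<rho>}"

definition char_degree :: "('a, 'b) monoid_scheme \<Rightarrow> ('a \<Rightarrow> complex) \<Rightarrow> nat" where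
  "char_degree G \<chi> = (THE d. \<chi> \<one>\<^bsub>G\<^esub> = of_nat d)"

definition char_ker :: "('a, 'b) monoid_scheme \<Rightarrow> ('a \<Rightarrow> complex) \<Rightarrow> 'a set" where
  "char_ker G \<chi> = {g \<in> carrier G. \<chi> g = \<chi> \<one>\<^bsub>G\<^esub>}"

text \<open>For a character \<open>\<phi>\<close> of the subgroup \<open>H\<close>; as \<open>\<phi>\<close> vanishes off \<open>H\<close>,
  only those \<open>x\<close> with \<open>x\<inverse> g x \<in> H\<close> contribute.\<close>

definition induced_char ::
  "('a, 'b) monoid_scheme \<Rightarrow> 'a set \<Rightarrow> ('a \<Rightarrow> complex) \<Rightarrow> 'a \<Rightarrow> complex" where
  "induced_char G H \<phi> =
     (\<lambda>g. if g \<in> carrier G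
          then (\<Sum>x\<in>carrier G. \<phi> (inv\<^bsub>G\<^esub> x \<otimes>\<^bsub>G\<^esub> g \<otimes>\<^bsub>G\<^esub> x)) / of_nat (card H)
          else 0)"

definition monomial_chars :: "('a, 'b) monoid_scheme \<Rightarrow> ('a \<Rightarrow> complex) set" where
  "monomial_chars G =
     {induced_char G H \<phi> | H \<phi>. subgroup H G \<and> \<phi> \<in> linear_chars (G\<lparr>carrier := H\<rparr>)}"

inductive_set monomial_monoid :: "('a, 'b) monoid_scheme \<Rightarrow> ('a \<Rightarrow> complex) set"
  for G :: "('a, 'b) monoid_scheme" where
  zero: "(\<lambda>g. 0) \<in> monomial_monoid G"
| gen: "\<chi> \<in> monomial_chars G \<Longrightarrow> \<chi> \<in> monomial_monoid G"
| add: "\<chi> \<in> monomial_monoid G \<Longrightarrow> \<psi> \<in> monomial_monoid G \<Longrightarrow>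
          (\<lambda>g. \<chi> g + \<psi> g) \<in> monomial_monoid G"


section \<open>Supercharacter theories\<close>

type_synonym 'a schar_theory = "('a \<Rightarrow> complex) set set \<times> 'a set set"

definition supercharacter :: "('a, 'b) monoid_scheme \<Rightarrow> ('a \<Rightarrow> complex) set \<Rightarrow> 'a \<Rightarrow> complex" where
  "supercharacter G X = (\<lambda>g. \<Sum>\<psi>\<in>X. \<psi> \<one>\<^bsub>G\<^esub> * \<psi> g)"

definition supercharacter_theory :: "('a, 'b) monoid_scheme \<Rightarrow> 'a schar_theory \<Rightarrow> bool" where
  "supercharacter_theory G = (\<lambda>(\<X>, \<K>).
     partition_on (Irr G) \<X> \<and>
     partition_on (carrier G) \<K> \<and>
     {\<one>\<^bsub>G\<^esub>} \<in> \<K> \<and>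
     card \<X> = card \<K> \<and>
     (\<forall>X\<in>\<X>. \<forall>K\<in>\<K>. \<forall>g\<in>K. \<forall>h\<in>K. supercharacter G X g = supercharacter G X h))"

definition supercharacter_comb ::
  "('a, 'b) monoid_scheme \<Rightarrow> 'a schar_theory \<Rightarrow> (('a \<Rightarrow> complex) set \<Rightarrow> nat) \<Rightarrow> 'a \<Rightarrow> complex" where
  "supercharacter_comb G C a = (\<lambda>g. \<Sum>X\<in>fst C. of_nat (a X) * supercharacter G X g)"

definition super_Ch :: "('a, 'b) monoid_scheme \<Rightarrow> 'a schar_theory \<Rightarrow> ('a \<Rightarrow> complex) set" where
  "super_Ch G C = range (supercharacter_comb G C)"

definition monomial_supermonoid ::
  "('a, 'b) monoid_scheme \<Rightarrow> 'a schar_theory \<Rightarrow> ('a \<Rightarrow> complex) set" where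
  "monomial_supermonoid G C = super_Ch G C \<inter> monomial_monoid G"

definition C_normal :: "('a, 'b) monoid_scheme \<Rightarrow> 'a schar_theory \<Rightarrow> 'a set \<Rightarrow> bool" where
  "C_normal G C N \<longleftrightarrow> N \<lhd> G \<and> (\<exists>S\<subseteq>snd C. N = \<Union>S)"

text \<open>The condition written \<open>X \<subset> Irr(G/N)\<close> for a set \<open>X\<close> of characters of \<open>G\<close>.\<close>

definition in_Irr_quotient ::
  "('a, 'b) monoid_scheme \<Rightarrow> 'a set \<Rightarrow> ('a \<Rightarrow> complex) set \<Rightarrow> bool" where
  "in_Irr_quotient G N X \<longleftrightarrow> (\<forall>\<chi>\<in>X. N \<subseteq> char_ker G \<chi>)"

text \<open>If \<open>N\<close> is contained in the kernel of \<open>\<chi>\<close>, then \<open>\<chi>\<close> is constant on each coset of \<open>N\<close>,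
  and \<open>the_elem\<close> picks that value.\<close>

definition deflate ::
  "('a, 'b) monoid_scheme \<Rightarrow> 'a set \<Rightarrow> ('a \<Rightarrow> complex) \<Rightarrow> 'a set \<Rightarrow> complex" where
  "deflate G N \<chi> = (\<lambda>A. if A \<in> carrier (G Mod N) then the_elem (\<chi> ` A) else 0)"

definition inflate ::
  "('a, 'b) monoid_scheme \<Rightarrow> 'a set \<Rightarrow> ('a set \<Rightarrow> complex) \<Rightarrow> 'a \<Rightarrow> complex" where
  "inflate G N \<psi> = (\<lambda>g. if g \<in> carrier G then \<psi> (N #>\<^bsub>G\<^esub> g) else 0)"

definition quotient_theory ::
  "('a, 'b) monoid_scheme \<Rightarrow> 'a schar_theory \<Rightarrow> 'a set \<Rightarrow> 'a set schar_theory" where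
  "quotient_theory G C N =
     ({deflate G N ` X | X. X \<in> fst C \<and> in_Irr_quotient G N X},
      {(\<lambda>k. N #>\<^bsub>G\<^esub> k) ` K | K. K \<in> snd C})"


section \<open>The algebras\<close>

text \<open>Polynomials over a field \<open>'k\<close> in variables indexed by \<open>'v\<close>.\<close>

type_synonym ('v, 'k) mpol = "('v \<Rightarrow>\<^sub>0 nat) \<Rightarrow>\<^sub>0 'k"

definition mpol_const :: "'k \<Rightarrow> ('v, 'k::field) mpol" where
  "mpol_const c = Poly_Mapping.single 0 c"

definition mpol_var :: "'v \<Rightarrow> ('v, 'k::field) mpol" where
  "mpol_var i = Poly_Mapping.single (Poly_Mapping.single i 1) 1"

global_interpretation mpol: vector_space "\<lambda>c p :: ('v, 'k::field) mpol. mpol_const c * p"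
  defines mpol_span = mpol.span
  by unfold_locales
    (simp_all add: mpol_const_def algebra_simps single_add mult_single flip: mult.assoc)

inductive_set generated_subalgebra :: "('v, 'k::field) mpol set \<Rightarrow> ('v, 'k) mpol set"
  for S :: "('v, 'k) mpol set" where
  const: "mpol_const c \<in> generated_subalgebra S"
| gen: "f \<in> S \<Longrightarrow> f \<in> generated_subalgebra S"
| add: "f \<in> generated_subalgebra S \<Longrightarrow> g \<in> generated_subalgebra S \<Longrightarrow>
          f + g \<in> generated_subalgebra S"
| mult: "f \<in> generated_subalgebra S \<Longrightarrow> g \<in> generated_subalgebra S \<Longrightarrow>
          f * g \<in> generated_subalgebra S"

text \<open>In what follows \<open>v\<close> assigns to each irreducible character the index of its variable.\<close>

definition char_monomial ::
  "('a, 'b) monoid_scheme \<Rightarrow> (('a \<Rightarrow> complex) \<Rightarrow> 'v) \<Rightarrow> ('a \<Rightarrow> complex) set \<Rightarrow> ('v, 'k::field) mpol" where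
  "char_monomial G v X = (\<Prod>\<chi>\<in>X. mpol_var (v \<chi>) ^ char_degree G \<chi>)"

definition monomial_algebra ::
  "('a, 'b) monoid_scheme \<Rightarrow> (('a \<Rightarrow> complex) \<Rightarrow> 'v) \<Rightarrow> 'a schar_theory \<Rightarrow> ('v, 'k::field) mpol set" where
  "monomial_algebra G v C =
     mpol_span {\<Prod>X\<in>fst C. char_monomial G v X ^ a X | a.
       supercharacter_comb G C a \<in> monomial_supermonoid G C}"

end

(* Inflation identifies R_{G/N,C~} with the span of those monomials F^a of R_{G,C} whose exponent
   vector a is supported on {1..p}, provided a character inflated from G/N lies in M(G) exactly if
   its deflation lies in M(G/N). Inflation commutes with induction, which gives one direction.
   Conversely, if N lies in the kernel of a sum of monomial characters, it lies in the kernel of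
   each summand lambda^G, since |lambda^G| is bounded by lambda^G(1); the formula for lambda^G(n)
   then forces N to lie in H and in the kernel of lambda, so lambda^G is inflated from a monomial
   character of G/N. The intersection with K[F_1,...,F_p] is computed on the monomial basis:
   the F_i are nontrivial monomials in disjoint sets of variables. *)

theory Submission
  imports Defs "HOL-Algebra.Multiplicative_Group"
begin

section \<open>Spans and subalgebras generated by monomials\<close>

lemma mpol_const_mult_single [simp]:
  "mpol_const c * Poly_Mapping.single e d = Poly_Mapping.single e (c * d)"
  by (simp add: mpol_const_def mult_single)

lemma prod_single:
  "(\<Prod>i\<in>A. Poly_Mapping.single (e i) (1::'k::comm_semiring_1)) = Poly_Mapping.single (\<Sum>i\<in>A. e i) 1"
  by (induction A rule: infinite_finite_induct) (simp_all add: mult_single)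

text \<open>The multiple of an exponent is written as a sum of copies, so that the claim is a case
  of \<open>prod_single\<close> and coordinates can later be read off with
  \<open>lookup_sum\<close>.\<close>

lemma single_power:
  "Poly_Mapping.single e (1::'k::comm_semiring_1) ^ n = Poly_Mapping.single (\<Sum>i<n. e) 1"
  using prod_single[of "\<lambda>_. e" "{..<n}"] by simp

text \<open>Together with \<open>mpol_span_if_keys\<close> this turns membership in a span of
  monomials into a condition on the support.\<close>

lemma keys_mpol_span:
  fixes q :: "('v, 'k::field) mpol"
  assumes "q \<in> mpol_span ((\<lambda>e. Poly_Mapping.single e 1) ` E)"
  shows "Poly_Mapping.keys q \<subseteq> E"
  using assms
proof (induction rule: mpol.span_induct_alt)
  case base
  then show ?case by simp
next
  case (step c x y)
  then obtain e where e: "e \<in> E" "x = Poly_Mapping.single e 1" by auto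
  have "Poly_Mapping.keys (mpol_const c * x + y) \<subseteq> Poly_Mapping.keys (mpol_const c * x) \<union> Poly_Mapping.keys y"
    by (rule keys_add)
  also have "\<dots> \<subseteq> E" using e step by auto
  finally show ?case .
qed

lemma mpol_span_if_keys:
  fixes q :: "('v, 'k::field) mpol"
  assumes "Poly_Mapping.keys q \<subseteq> E"
  shows "q \<in> mpol_span ((\<lambda>e. Poly_Mapping.single e 1) ` E)"
proof -
  have "q = (\<Sum>e\<in>Poly_Mapping.keys q. Poly_Mapping.single e (Poly_Mapping.lookup q e))"
    by (rule poly_mapping_eqI) (simp add: lookup_sum lookup_single when_def in_keys_iff sum.delta')
  also have "\<dots> = (\<Sum>e\<in>Poly_Mapping.keys q. mpol_const (Poly_Mapping.lookup q e) * Poly_Mapping.single e 1)"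
    by simp
  also have "\<dots> \<in> mpol_span ((\<lambda>e. Poly_Mapping.single e 1) ` E)"
    using assms by (intro mpol.span_sum mpol.span_scale mpol.span_base) auto
  finally show ?thesis .
qed

text \<open>Exponents of a product are sums of exponents of the factors, so the polynomials
  supported in a monoid \<open>M\<close> of exponents form a subalgebra. In the end \<open>M\<close>
  consists of the exponents that avoid certain variables.\<close>

lemma keys_generated_subalgebra:
  fixes q :: "('v, 'k::field) mpol"
  assumes "q \<in> generated_subalgebra S"
    and S: "\<And>f. f \<in> S \<Longrightarrow> Poly_Mapping.keys f \<subseteq> M"
    and M: "0 \<in> M" "\<And>d e. d \<in> M \<Longrightarrow> e \<in> M \<Longrightarrow> d + e \<in> M"
  shows "Poly_Mapping.keys q \<subseteq> M"
  using assms(1)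
proof induction
  case (const c)
  then show ?case using M by (simp add: mpol_const_def)
next
  case (gen f)
  then show ?case by (rule S)
next
  case (add f g)
  then show ?case using keys_add[of f g] by blast
next
  case (mult f g)
  then show ?case using keys_mult[of f g] M by blast
qed

lemma subspace_generated_subalgebra:
  "mpol.subspace (generated_subalgebra S :: ('v, 'k::field) mpol set)"
proof (rule mpol.subspaceI)
  show "0 \<in> (generated_subalgebra S :: ('v, 'k) mpol set)"
    using generated_subalgebra.const[of 0 S] by (simp add: mpol_const_def)
qed (auto intro: generated_subalgebra.intros)

lemma generated_subalgebra_power:
  "f \<in> generated_subalgebra S \<Longrightarrow> f ^ n \<in> generated_subalgebra S"
proof (induction n)
  case 0
  then show ?case using generated_subalgebra.const[of 1 S] by (simp add: mpol_const_def)
qed (auto intro: generated_subalgebra.mult)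

lemma generated_subalgebra_prod:
  "(\<And>i. i \<in> A \<Longrightarrow> f i \<in> generated_subalgebra S) \<Longrightarrow> prod f A \<in> generated_subalgebra S"
proof (induction A rule: infinite_finite_induct)
  case (insert x A)
  then show ?case by (auto intro: generated_subalgebra.mult)
qed (use generated_subalgebra.const[of 1 S] in \<open>simp_all add: mpol_const_def\<close>)


section \<open>Irreducible and linear characters\<close>

text \<open>A matrix of size one is its only entry, and multiplying such matrices multiplies the
  entries. The vanishing off the carrier is kept because it later allows \<open>H\<close> to be
  detected from nonzero values of \<open>\<phi>\<close>.\<close>

lemma (in monoid) linear_chars_iff:
  "\<phi> \<in> linear_chars G \<longleftrightarrow>
     \<phi> \<one> = 1 \<and> (\<forall>g\<in>carrier G. \<forall>h\<in>carrier G. \<phi> (g \<otimes> h) = \<phi> g * \<phi> h) \<and>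
     (\<forall>g. g \<notin> carrier G \<longrightarrow> \<phi> g = 0)"  (is "_ \<longleftrightarrow> ?R")
proof
  assume "\<phi> \<in> linear_chars G"
  then obtain \<rho> where \<rho>: "is_rep G 1 \<rho>" "\<phi> = rep_char G \<rho>"
    by (auto simp: linear_chars_def)
  have dim: "\<rho> g \<in> carrier_mat 1 1" if "g \<in> carrier G" for g
    using \<rho> that by (simp add: is_rep_def)
  have eq: "\<phi> g = \<rho> g $$ (0,0)" if "g \<in> carrier G" for g
    using dim[OF that] that \<rho> by (auto simp: rep_char_def)
  have "\<phi> (g \<otimes> h) = \<phi> g * \<phi> h" if "g \<in> carrier G" "h \<in> carrier G" for g h
  proof -
    have "\<rho> (g \<otimes> h) = \<rho> g * \<rho> h" using \<rho> that by (simp add: is_rep_def)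
    then show ?thesis using dim[OF that(1)] dim[OF that(2)] that
      by (simp add: eq scalar_prod_def)
  qed
  moreover have "\<phi> \<one> = 1" using \<rho> eq[of \<one>] by (simp add: is_rep_def)
  ultimately show ?R using \<rho> by (simp add: rep_char_def)
next
  assume R: ?R
  define \<rho> where "\<rho> g = mat 1 1 (\<lambda>_. \<phi> g)" for g
  have "is_rep G 1 \<rho>" unfolding is_rep_def \<rho>_def using R
    by (auto intro!: eq_matI simp: scalar_prod_def)
  moreover have "\<phi> = rep_char G \<rho>" using R by (auto simp: rep_char_def \<rho>_def)
  ultimately show "\<phi> \<in> linear_chars G" by (auto simp: linear_chars_def)
qed

text \<open>The values are roots of unity, because the group order kills \<open>g\<close>.\<close>

lemma (in group) norm_linear_char:
  assumes fin: "finite (carrier G)" and \<phi>: "\<phi> \<in> linear_chars G" and g: "g \<in> carrier G"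
  shows "norm (\<phi> g) = 1"
proof -
  have pow: "\<phi> (g [^] n) = \<phi> g ^ n" for n :: nat
    using \<phi> g by (induction n) (auto simp: linear_chars_iff)
  have "\<phi> g ^ order G = 1"
    using pow[of "order G"] \<phi> g by (simp add: pow_order_eq_1 linear_chars_iff)
  then have "norm (\<phi> g) ^ order G = 1" by (metis norm_one norm_power)
  moreover have "order G > 0" using fin g by (auto simp: order_def card_gt_0_iff)
  ultimately show ?thesis using power_eq_iff_eq_base[of "order G" "norm (\<phi> g)" 1] by simp
qed

lemma char_one:
  assumes "group G" "is_rep G d \<rho>"
  shows "rep_char G \<rho> \<one>\<^bsub>G\<^esub> = of_nat d"
  using assms by (simp add: is_rep_def rep_char_def group.is_monoid)

lemma char_degree_eqI: "\<chi> \<one>\<^bsub>G\<^esub> = of_nat d \<Longrightarrow> char_degree G \<chi> = d"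
  unfolding char_degree_def by (rule the_equality) auto

lemma char_degree_pos:
  assumes "group G" "\<chi> \<in> Irr G"
  shows "char_degree G \<chi> > 0"
proof -
  obtain d \<rho> where "irreducible_rep G d \<rho>" "\<chi> = rep_char G \<rho>"
    using assms by (auto simp: Irr_def)
  then show ?thesis
    using char_degree_eqI[of \<chi> G d] char_one[OF assms(1), of d \<rho>]
    by (simp add: irreducible_rep_def)
qed

lemma Irr_outside: "\<chi> \<in> Irr G \<Longrightarrow> g \<notin> carrier G \<Longrightarrow> \<chi> g = 0"
  by (auto simp: Irr_def rep_char_def)


section \<open>Inflation from the quotient by a normal subgroup\<close>

locale finite_normal = normal N G for N and G (structure) +
  assumes fin: "finite (carrier G)"
begin

lemma finN: "finite N"
  using fin subset finite_subset by blast

lemma card_N_pos: "card N > 0"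
  using finN subgroup.one_closed[OF subgroup_axioms] unfolding card_gt_0_iff by blast

sublocale Q: group "G Mod N"
  by (rule factorgroup_is_group)

sublocale Q: group_hom G "G Mod N" "\<lambda>x. N #> x"
  by unfold_locales (rule r_coset_hom_Mod)

lemma carrier_Mod: "carrier (G Mod N) = (\<lambda>x. N #> x) ` carrier G"
  by (auto simp: FactGroup_def RCOSETS_def)

lemma fin_Mod: "finite (carrier (G Mod N))"
  using fin by (simp add: carrier_Mod)

lemma one_Mod: "\<one>\<^bsub>G Mod N\<^esub> = N"
  by (simp add: FactGroup_def)

lemma coset_eqD:
  assumes "x \<in> carrier G" "y \<in> carrier G" "N #> x = N #> y"
  shows "\<exists>n\<in>N. x = n \<otimes> y"
proof -
  have "x \<in> N #> y" using rcos_self[OF assms(1) subgroup_axioms] assms(3) by simp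
  then show ?thesis by (auto simp: r_coset_def)
qed

lemma coset_absorb:
  assumes "n \<in> N" "g \<in> carrier G"
  shows "N #> (n \<otimes> g) = N #> g"
  using assms coset_mult_assoc[OF subset mem_carrier[OF assms(1)] assms(2)]
    coset_join2[OF mem_carrier[OF assms(1)] subgroup_axioms] by simp

text \<open>The fibre of the projection over a coset is that coset itself, which has
  \<open>card N\<close> elements. A general \<open>U\<close> serves both for sums over the whole
  quotient and for counting preimages of subgroups.\<close>

lemma sum_over_Mod:
  fixes F :: "'a set \<Rightarrow> complex"
  assumes "U \<subseteq> carrier (G Mod N)"
  shows "(\<Sum>x | x \<in> carrier G \<and> N #> x \<in> U. F (N #> x)) = of_nat (card N) * (\<Sum>A\<in>U. F A)"
proof -
  let ?P = "{x. x \<in> carrier G \<and> N #> x \<in> U}"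
  have fin': "finite ?P" "finite U" using fin finite_subset[OF assms fin_Mod] by auto
  have "(\<Sum>x\<in>?P. F (N #> x)) = (\<Sum>A\<in>U. \<Sum>x | x \<in> ?P \<and> N #> x = A. F (N #> x))"
    by (rule sum.group[symmetric]) (use fin' in auto)
  also have "\<dots> = (\<Sum>A\<in>U. of_nat (card N) * F A)"
  proof (rule sum.cong[OF refl])
    fix A assume A: "A \<in> U"
    then obtain y where y: "y \<in> carrier G" "A = N #> y" using assms carrier_Mod by blast
    have "{x. x \<in> ?P \<and> N #> x = A} = A"
    proof safe
      fix x assume "x \<in> carrier G" "A = N #> x"
      then show "x \<in> N #> x" using rcos_self[OF _ subgroup_axioms] by simp
    next
      fix x assume "x \<in> A"
      then obtain n where n: "n \<in> N" "x = n \<otimes> y" using y by (auto simp: r_coset_def)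
      have *: "x \<in> carrier G" "N #> x = A" using n y coset_absorb by auto
      show "x \<in> carrier G" "N #> x \<in> U" using * A by auto
      show "\<And>z. z \<in> N #> x \<Longrightarrow> z \<in> A" "\<And>z. z \<in> A \<Longrightarrow> z \<in> N #> x" using * by auto
    qed
    moreover have "card A = card N"
      using card_rcosets_equal[of A N] y subset by (simp add: rcosetsI)
    moreover have "(\<Sum>x | x \<in> ?P \<and> N #> x = A. F (N #> x)) = (\<Sum>x | x \<in> ?P \<and> N #> x = A. F A)"
      by (rule sum.cong) auto
    ultimately show "(\<Sum>x | x \<in> ?P \<and> N #> x = A. F (N #> x)) = of_nat (card N) * F A"
      by simp
  qed
  finally show ?thesis by (simp add: sum_distrib_left)
qed

lemma card_preimage:
  assumes "U \<subseteq> carrier (G Mod N)"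
  shows "card {x \<in> carrier G. N #> x \<in> U} = card N * card U"
proof -
  have "complex_of_nat (card {x \<in> carrier G. N #> x \<in> U}) = of_nat (card N * card U)"
    using sum_over_Mod[OF assms, of "\<lambda>_. 1"] by simp
  then show ?thesis by (simp only: of_nat_eq_iff)
qed

text \<open>The image of the coset is a singleton, so \<open>the_elem\<close> is meaningful. Only
  invariance under \<open>N\<close> is assumed, which covers both irreducible characters of the
  group and linear characters of subgroups.\<close>

lemma deflate_coset:
  assumes f: "\<And>n g. n \<in> N \<Longrightarrow> g \<in> carrier G \<Longrightarrow> f (n \<otimes> g) = f g" and g: "g \<in> carrier G"
  shows "deflate G N f (N #> g) = f g"
proof -
  have "f x = f g" if "x \<in> N #> g" for x using that f[OF _ g] by (auto simp: r_coset_def)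
  moreover have "g \<in> N #> g" using rcos_self[OF g subgroup_axioms] .
  ultimately have "f ` (N #> g) = {f g}" by blast
  then show ?thesis using g by (auto simp: deflate_def carrier_Mod)
qed

lemma inflate_deflate:
  assumes "\<And>n g. n \<in> N \<Longrightarrow> g \<in> carrier G \<Longrightarrow> f (n \<otimes> g) = f g"
    and "\<And>g. g \<notin> carrier G \<Longrightarrow> f g = 0"
  shows "inflate G N (deflate G N f) = f"
  using assms by (auto simp: inflate_def deflate_coset)

lemma inflate_inject:
  assumes "inflate G N f = inflate G N h"
    and "\<And>A. A \<notin> carrier (G Mod N) \<Longrightarrow> f A = 0" "\<And>A. A \<notin> carrier (G Mod N) \<Longrightarrow> h A = 0"
  shows "f = h"
proof
  fix A
  show "f A = h A"
  proof (cases "A \<in> carrier (G Mod N)")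
    case True
    then obtain g where "g \<in> carrier G" "A = N #> g" by (auto simp: carrier_Mod)
    then show ?thesis using fun_cong[OF assms(1), of g] by (simp add: inflate_def)
  qed (simp add: assms)
qed

section \<open>Inflation of induced and monomial characters\<close>

text \<open>The sum over the group is \<open>card N\<close> times the sum over the quotient, and the
  preimage of \<open>U\<close> is \<open>card N\<close> times as large as \<open>U\<close>, so the
  two factors cancel.\<close>

lemma inflate_induced_char:
  assumes "subgroup U (G Mod N)"
  shows "inflate G N (induced_char (G Mod N) U \<phi>) =
         induced_char G {x \<in> carrier G. N #> x \<in> U} (inflate G N \<phi>)"
proof
  fix g
  show "inflate G N (induced_char (G Mod N) U \<phi>) g =
         induced_char G {x \<in> carrier G. N #> x \<in> U} (inflate G N \<phi>) g"
  proof (cases "g \<in> carrier G")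
    case g: True
    let ?F = "\<lambda>A. \<phi> (inv\<^bsub>G Mod N\<^esub> A \<otimes>\<^bsub>G Mod N\<^esub> (N #> g) \<otimes>\<^bsub>G Mod N\<^esub> A)"
    have "(\<Sum>x\<in>carrier G. inflate G N \<phi> (inv x \<otimes> g \<otimes> x)) =
          (\<Sum>x | x \<in> carrier G \<and> N #> x \<in> carrier (G Mod N). ?F (N #> x))"
      using g by (intro sum.cong) (auto simp: inflate_def carrier_Mod)
    also have "\<dots> = of_nat (card N) * (\<Sum>A\<in>carrier (G Mod N). ?F A)"
      by (rule sum_over_Mod) simp
    finally have "(\<Sum>x\<in>carrier G. inflate G N \<phi> (inv x \<otimes> g \<otimes> x)) =
       of_nat (card N) * (\<Sum>A\<in>carrier (G Mod N). ?F A)" .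
    moreover have "card {x \<in> carrier G. N #> x \<in> U} = card N * card U"
      using assms by (intro card_preimage subgroup.subset)
    ultimately show ?thesis using g card_N_pos
      by (simp add: inflate_def induced_char_def carrier_Mod)
  qed (simp add: inflate_def induced_char_def)
qed

lemma inflate_linear_char:
  assumes U: "subgroup U (G Mod N)" and \<phi>: "\<phi> \<in> linear_chars ((G Mod N)\<lparr>carrier := U\<rparr>)"
  shows "inflate G N \<phi> \<in> linear_chars (G\<lparr>carrier := {x \<in> carrier G. N #> x \<in> U}\<rparr>)"
    and "subgroup {x \<in> carrier G. N #> x \<in> U} G"
proof -
  let ?H = "{x \<in> carrier G. N #> x \<in> U}"
  interpret U: group "(G Mod N)\<lparr>carrier := U\<rparr>"
    using U by (rule Q.subgroup_imp_group)
  have N: "N \<in> U" using U subgroup.one_closed one_Mod by metis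
  show H: "subgroup ?H G"
  proof (rule subgroup.intro)
    show "x \<otimes> y \<in> ?H" if "x \<in> ?H" "y \<in> ?H" for x y
      using that subgroup.m_closed[OF U, of "N #> x" "N #> y"] by auto
    show "inv x \<in> ?H" if "x \<in> ?H" for x
      using that subgroup.m_inv_closed[OF U, of "N #> x"] by auto
    show "\<one> \<in> ?H" using N coset_mult_one[OF subset] by simp
  qed auto
  interpret H: group "G\<lparr>carrier := ?H\<rparr>"
    using H by (rule subgroup_imp_group)
  have \<phi>': "\<phi> N = 1" "\<And>A B. A \<in> U \<Longrightarrow> B \<in> U \<Longrightarrow> \<phi> (A \<otimes>\<^bsub>G Mod N\<^esub> B) = \<phi> A * \<phi> B"
    "\<And>A. A \<notin> U \<Longrightarrow> \<phi> A = 0"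
    using \<phi> unfolding U.linear_chars_iff by (auto simp: one_Mod)
  show "inflate G N \<phi> \<in> linear_chars (G\<lparr>carrier := ?H\<rparr>)"
    unfolding H.linear_chars_iff
    using \<phi>'(1,3) by (auto simp: inflate_def coset_mult_one[OF subset] one_Mod \<phi>'(2) simp del: mult_FactGroup)
qed

lemma inflate_monomial_char:
  assumes "\<psi> \<in> monomial_chars (G Mod N)"
  shows "inflate G N \<psi> \<in> monomial_chars G"
  using assms inflate_induced_char inflate_linear_char unfolding monomial_chars_def by blast

lemma inflate_monomial_monoid:
  assumes "\<psi> \<in> monomial_monoid (G Mod N)"
  shows "inflate G N \<psi> \<in> monomial_monoid G"
  using assms
proof induction
  case zero
  have "inflate G N (\<lambda>g. 0) = (\<lambda>g. 0)" by (auto simp: inflate_def)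
  then show ?case by (metis monomial_monoid.zero)
next
  case (gen \<chi>)
  then show ?case by (intro monomial_monoid.gen inflate_monomial_char)
next
  case (add \<chi> \<psi>)
  have "inflate G N (\<lambda>g. \<chi> g + \<psi> g) = (\<lambda>g. inflate G N \<chi> g + inflate G N \<psi> g)"
    by (auto simp: inflate_def)
  then show ?case using add by (metis monomial_monoid.add)
qed

end

section \<open>Support and absolute values of monomial characters\<close>

lemma monomial_monoid_outside:
  "\<chi> \<in> monomial_monoid G \<Longrightarrow> g \<notin> carrier G \<Longrightarrow> \<chi> g = 0"
  by (induction rule: monomial_monoid.induct) (auto simp: monomial_chars_def induced_char_def)

text \<open>The modulus is 1 on \<open>H\<close> and 0 elsewhere, so the bound applies to every term
  of an induced character.\<close>

lemma (in group) norm_linear_char_subgroup: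
  assumes fin: "finite (carrier G)" and H: "subgroup H G"
    and \<phi>: "\<phi> \<in> linear_chars (G\<lparr>carrier := H\<rparr>)"
  shows "norm (\<phi> x) \<le> 1"
proof -
  interpret H: group "G\<lparr>carrier := H\<rparr>"
    using H by (rule subgroup_imp_group)
  show ?thesis
  proof (cases "x \<in> H")
    case True
    then show ?thesis
      using H.norm_linear_char[OF _ \<phi>, of x] finite_subset[OF subgroup.subset[OF H] fin] by simp
  next
    case False
    then show ?thesis using \<phi> unfolding H.linear_chars_iff by simp
  qed
qed

lemma (in group) linear_char_subgroup_one:
  assumes "subgroup H G" "\<phi> \<in> linear_chars (G\<lparr>carrier := H\<rparr>)"
  shows "\<phi> \<one> = 1"
proof -
  interpret H: group "G\<lparr>carrier := H\<rparr>"
    using assms by (intro subgroup_imp_group)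
  show ?thesis using assms unfolding H.linear_chars_iff by simp
qed

text \<open>The triangle inequality bounds the inducing sum by the group order, and at the identity
  every term equals 1. That the degree is a real number is recorded through its real and imaginary
  parts.\<close>

lemma (in group) norm_monomial_char_le:
  assumes fin: "finite (carrier G)" and \<chi>: "\<chi> \<in> monomial_chars G" and g: "g \<in> carrier G"
  shows "norm (\<chi> g) \<le> Re (\<chi> \<one>)" and "Im (\<chi> \<one>) = 0"
proof -
  obtain H \<phi> where H: "subgroup H G" "\<phi> \<in> linear_chars (G\<lparr>carrier := H\<rparr>)" "\<chi> = induced_char G H \<phi>"
    using \<chi> by (auto simp: monomial_chars_def)
  have one: "\<chi> \<one> = of_nat (card (carrier G)) / of_nat (card H)"
    using linear_char_subgroup_one[OF H(1,2)] by (simp add: H induced_char_def)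
  have "norm (\<Sum>x\<in>carrier G. \<phi> (inv x \<otimes> g \<otimes> x)) \<le> (\<Sum>x\<in>carrier G. 1)"
    by (rule sum_norm_le) (rule norm_linear_char_subgroup[OF fin H(1,2)])
  then show "norm (\<chi> g) \<le> Re (\<chi> \<one>)"
    using g unfolding one by (simp add: H induced_char_def norm_divide divide_right_mono)
  show "Im (\<chi> \<one>) = 0" unfolding one by simp
qed

lemma (in group) norm_monomial_monoid_le:
  assumes fin: "finite (carrier G)" and \<chi>: "\<chi> \<in> monomial_monoid G" and g: "g \<in> carrier G"
  shows "norm (\<chi> g) \<le> Re (\<chi> \<one>) \<and> Im (\<chi> \<one>) = 0"
  using \<chi>
proof induction
  case (gen \<chi>)
  then show ?case using norm_monomial_char_le[OF fin _ g] by blast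
next
  case (add \<chi> \<psi>)
  then show ?case using norm_triangle_ineq[of "\<chi> g" "\<psi> g"] by auto
qed simp

text \<open>Once the real part uses up the whole bound on the modulus, nothing is left for the
  imaginary part.\<close>

lemma Re_eq_norm_boundD:
  fixes z :: complex
  assumes "norm z \<le> c" "Re z = c"
  shows "z = of_real c"
proof -
  have "(Re z)\<^sup>2 + (Im z)\<^sup>2 \<le> c\<^sup>2"
    using assms(1) power_mono[OF assms(1) norm_ge_zero, of 2] by (simp add: cmod_power2)
  then show ?thesis using assms(2) by (simp add: complex_eq_iff)
qed

section \<open>Deflation of monomial characters whose kernel contains \<open>N\<close>\<close>

context finite_normal
begin

text \<open>Equality in the triangle inequality for \<open>\<lambda>\<^sup>G(n) = \<lambda>\<^sup>G(1)\<close> forces every conjugate of \<open>n\<close> to lie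
  in the subgroup and in the kernel of \<open>\<lambda>\<close>.\<close>

lemma monomial_char_kernel:
  assumes H: "subgroup H G" and \<phi>: "\<phi> \<in> linear_chars (G\<lparr>carrier := H\<rparr>)"
    and ker: "\<And>n. n \<in> N \<Longrightarrow> induced_char G H \<phi> n = induced_char G H \<phi> \<one>" and n: "n \<in> N"
  shows "\<phi> n = 1"
proof -
  have le: "norm (\<phi> x) \<le> 1" for x by (rule norm_linear_char_subgroup[OF fin H \<phi>])
  have nG: "n \<in> carrier G" using n by simp
  have cH: "card H > 0"
    using finite_subset[OF subgroup.subset[OF H] fin] subgroup.one_closed[OF H]
    unfolding card_gt_0_iff by blast
  have "(\<Sum>x\<in>carrier G. \<phi> (inv x \<otimes> n \<otimes> x)) = of_nat (card (carrier G))"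
    using ker[OF n] nG cH linear_char_subgroup_one[OF H \<phi>] by (simp add: induced_char_def)
  \<comment> \<open>Real parts turn the equality into a vanishing sum of nonnegative terms, so every
    term is zero; the term at the identity concerns \<open>n\<close> itself.\<close>
  then have "(\<Sum>x\<in>carrier G. 1 - Re (\<phi> (inv x \<otimes> n \<otimes> x))) = 0"
    by (simp add: sum_subtractf flip: Re_sum)
  moreover have "0 \<le> 1 - Re (\<phi> x)" for x
    using le[of x] complex_Re_le_cmod[of "\<phi> x"] by linarith
  ultimately have "\<forall>x\<in>carrier G. 1 - Re (\<phi> (inv x \<otimes> n \<otimes> x)) = 0"
    using fin by (subst (asm) sum_nonneg_eq_0_iff) auto
  from bspec[OF this, of \<one>] have "Re (\<phi> n) = 1" using nG by simp
  then show ?thesis using Re_eq_norm_boundD[OF le] by simp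
qed

lemma deflate_monomial_char:
  assumes \<chi>: "\<chi> \<in> monomial_chars G" and ker: "\<And>n. n \<in> N \<Longrightarrow> \<chi> n = \<chi> \<one>"
  shows "\<exists>\<psi>\<in>monomial_chars (G Mod N). \<chi> = inflate G N \<psi>"
proof -
  obtain H \<phi> where H: "subgroup H G" and \<phi>: "\<phi> \<in> linear_chars (G\<lparr>carrier := H\<rparr>)"
    and \<chi>: "\<chi> = induced_char G H \<phi>"
    using \<chi> by (auto simp: monomial_chars_def)
  interpret H: subgroup H G by (rule H)
  interpret HG: group "G\<lparr>carrier := H\<rparr>"
    using H by (rule subgroup_imp_group)
  have \<phi>': "\<phi> \<one> = 1" "\<And>g h. g \<in> H \<Longrightarrow> h \<in> H \<Longrightarrow> \<phi> (g \<otimes> h) = \<phi> g * \<phi> h"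
    "\<And>g. g \<notin> H \<Longrightarrow> \<phi> g = 0"
    using \<phi> unfolding HG.linear_chars_iff by auto
  have one: "\<phi> n = 1" if "n \<in> N" for n
    using monomial_char_kernel[OF H \<phi> _ that] ker \<chi> by blast
  \<comment> \<open>Off \<open>H\<close> the value of \<open>\<phi>\<close> would be 0 instead of
    1.\<close>
  have NH: "n \<in> H" if "n \<in> N" for n
    using one[OF that] \<phi>'(3)[of n] by fastforce
  \<comment> \<open>Since \<open>N\<close> lies in \<open>H\<close>, multiplication by
    \<open>n\<close> preserves both \<open>H\<close> and its complement; hence \<open>\<phi>\<close>
    descends to the quotient.\<close>
  have const: "\<phi> (n \<otimes> g) = \<phi> g" if n: "n \<in> N" and g: "g \<in> carrier G" for n g
  proof (cases "g \<in> H")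
    case True
    then show ?thesis using \<phi>'(2)[OF NH[OF n]] one[OF n] by simp
  next
    case False
    have "n \<otimes> g \<notin> H"
    proof
      assume "n \<otimes> g \<in> H"
      then have "inv n \<otimes> (n \<otimes> g) \<in> H" by (rule H.m_closed[OF H.m_inv_closed[OF NH[OF n]]])
      moreover have "inv n \<otimes> (n \<otimes> g) = g" using n g by (simp flip: m_assoc)
      ultimately show False using False by metis
    qed
    then show ?thesis using False \<phi>'(3) by simp
  qed
  \<comment> \<open>This is \<open>H/N\<close>; its full preimage is \<open>H\<close> again because
    \<open>H\<close> contains \<open>N\<close>, so \<open>inflate_induced_char\<close> recovers
    \<open>\<chi>\<close>.\<close>
  define U where "U = (\<lambda>x. N #> x) ` H"
  have U: "subgroup U (G Mod N)"
    unfolding U_def using H by (rule Q.subgroup_img_is_subgroup)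
  interpret UQ: group "(G Mod N)\<lparr>carrier := U\<rparr>"
    using U by (rule Q.subgroup_imp_group)
  have preim: "{x \<in> carrier G. N #> x \<in> U} = H"
  proof safe
    fix x assume x: "x \<in> carrier G" "N #> x \<in> U"
    then obtain h where h: "h \<in> H" "N #> x = N #> h" by (auto simp: U_def)
    then obtain n where "n \<in> N" "x = n \<otimes> h" using coset_eqD[OF x(1) H.mem_carrier] by blast
    then show "x \<in> H" using NH h by simp
  qed (auto simp: U_def)
  have infl: "inflate G N (deflate G N \<phi>) = \<phi>"
    using const \<phi>'(3) H.subset by (intro inflate_deflate) auto
  have defl: "deflate G N \<phi> (N #> g) = \<phi> g" if "g \<in> carrier G" for g
    using deflate_coset const that by blast
  have "deflate G N \<phi> \<in> linear_chars ((G Mod N)\<lparr>carrier := U\<rparr>)"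
    unfolding UQ.linear_chars_iff
  proof (intro conjI ballI allI impI)
    show "deflate G N \<phi> \<one>\<^bsub>(G Mod N)\<lparr>carrier := U\<rparr>\<^esub> = 1"
      using defl[of \<one>] \<phi>'(1) coset_mult_one[OF subset] by (simp add: one_Mod)
  next
    fix A B assume "A \<in> carrier ((G Mod N)\<lparr>carrier := U\<rparr>)" "B \<in> carrier ((G Mod N)\<lparr>carrier := U\<rparr>)"
    then show "deflate G N \<phi> (A \<otimes>\<^bsub>(G Mod N)\<lparr>carrier := U\<rparr>\<^esub> B) = deflate G N \<phi> A * deflate G N \<phi> B"
      using \<phi>'(2) by (auto simp: U_def defl simp flip: Q.hom_mult simp del: mult_FactGroup)
  next
    fix A assume A: "A \<notin> carrier ((G Mod N)\<lparr>carrier := U\<rparr>)"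
    show "deflate G N \<phi> A = 0"
    proof (cases "A \<in> carrier (G Mod N)")
      case True
      then obtain g where g: "g \<in> carrier G" "A = N #> g" by (auto simp: carrier_Mod)
      then have "g \<notin> H" using A by (auto simp: U_def)
      then show ?thesis using g defl \<phi>'(3) by simp
    qed (simp add: deflate_def)
  qed
  then have "induced_char (G Mod N) U (deflate G N \<phi>) \<in> monomial_chars (G Mod N)"
    using U by (auto simp: monomial_chars_def)
  moreover have "\<chi> = inflate G N (induced_char (G Mod N) U (deflate G N \<phi>))"
    using inflate_induced_char[OF U] by (simp add: preim infl \<chi>)
  ultimately show ?thesis by blast
qed

lemma deflate_monomial_monoid:
  assumes "\<chi> \<in> monomial_monoid G" and "\<And>n. n \<in> N \<Longrightarrow> \<chi> n = \<chi> \<one>"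
  shows "\<exists>\<psi>\<in>monomial_monoid (G Mod N). \<chi> = inflate G N \<psi>"
  using assms
proof induction
  case zero
  have "(\<lambda>g. 0) = inflate G N (\<lambda>g. 0)" by (auto simp: inflate_def)
  then show ?case using monomial_monoid.zero by blast
next
  case (gen \<chi>)
  then show ?case using deflate_monomial_char monomial_monoid.gen by blast
next
  case (add \<chi>1 \<chi>2)
  \<comment> \<open>Each real part at \<open>n\<close> is at most the degree of its summand, and the
    totals agree, so both bounds are attained and the equality case applies to each summand.\<close>
  have "\<chi>1 n = \<chi>1 \<one> \<and> \<chi>2 n = \<chi>2 \<one>" if n: "n \<in> N" for n
  proof -
    have b: "norm (\<chi>1 n) \<le> Re (\<chi>1 \<one>)" "Im (\<chi>1 \<one>) = 0" "norm (\<chi>2 n) \<le> Re (\<chi>2 \<one>)" "Im (\<chi>2 \<one>) = 0"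
      using norm_monomial_monoid_le[OF fin add(1) mem_carrier[OF n]]
        norm_monomial_monoid_le[OF fin add(2) mem_carrier[OF n]] by auto
    have "Re (\<chi>1 n) + Re (\<chi>2 n) = Re (\<chi>1 \<one>) + Re (\<chi>2 \<one>)"
      using arg_cong[OF add.prems[OF n], of Re] by simp
    then have "Re (\<chi>1 n) = Re (\<chi>1 \<one>)" "Re (\<chi>2 n) = Re (\<chi>2 \<one>)"
      using b complex_Re_le_cmod[of "\<chi>1 n"] complex_Re_le_cmod[of "\<chi>2 n"] by linarith+
    then show ?thesis using Re_eq_norm_boundD[OF b(1)] Re_eq_norm_boundD[OF b(3)] b(2,4)
      by (simp add: complex_eq_iff)
  qed
  then obtain \<psi>1 \<psi>2 where "\<psi>1 \<in> monomial_monoid (G Mod N)" "\<psi>2 \<in> monomial_monoid (G Mod N)"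
    "\<chi>1 = inflate G N \<psi>1" "\<chi>2 = inflate G N \<psi>2"
    using add.IH by metis
  moreover from this have "(\<lambda>g. \<chi>1 g + \<chi>2 g) = inflate G N (\<lambda>g. \<psi>1 g + \<psi>2 g)"
    by (auto simp: inflate_def)
  ultimately show ?case using monomial_monoid.add by blast
qed

text \<open>Deflation supplies some element of the monoid with the same inflation; as both functions
  vanish off the quotient, injectivity identifies it with \<open>f\<close>.\<close>

lemma inflate_monomial_monoid_iff:
  assumes "\<And>A. A \<notin> carrier (G Mod N) \<Longrightarrow> f A = 0"
  shows "inflate G N f \<in> monomial_monoid G \<longleftrightarrow> f \<in> monomial_monoid (G Mod N)"
proof
  assume "inflate G N f \<in> monomial_monoid G"
  moreover have "inflate G N f n = inflate G N f \<one>" if "n \<in> N" for n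
    using that coset_join2[OF _ subgroup_axioms, of n] coset_mult_one[OF subset]
    by (simp add: inflate_def)
  ultimately obtain \<psi> where \<psi>: "\<psi> \<in> monomial_monoid (G Mod N)" "inflate G N f = inflate G N \<psi>"
    using deflate_monomial_monoid by blast
  then have "f = \<psi>"
    using assms by (intro inflate_inject) (auto intro: monomial_monoid_outside)
  then show "f \<in> monomial_monoid (G Mod N)" using \<psi> by simp
qed (rule inflate_monomial_monoid)

section \<open>Irreducible characters whose kernel contains \<open>N\<close>\<close>

text \<open>The \<open>N\<close>-fixed vectors form an invariant subspace. It contains the columns of
  \<open>\<Sum>n\<in>N. \<rho> n\<close>, whose trace is \<open>card N * d\<close>, so it is the whole space by irreducibility.\<close>

lemma irreducible_rep_fixes:
  assumes irr: "irreducible_rep G d \<rho>" and ker: "N \<subseteq> char_ker G (rep_char G \<rho>)"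
    and n: "n \<in> N" and w: "w \<in> carrier_vec d"
  shows "\<rho> n *\<^sub>v w = w"
proof -
  have rep: "is_rep G d \<rho>" and d: "d > 0" using irr by (auto simp: irreducible_rep_def)
  have dim: "\<rho> g \<in> carrier_mat d d" if "g \<in> carrier G" for g
    using rep that by (simp add: is_rep_def)
  have mul: "\<rho> (g \<otimes> h) = \<rho> g * \<rho> h" if "g \<in> carrier G" "h \<in> carrier G" for g h
    using rep that by (simp add: is_rep_def)
  define W where "W = {w \<in> carrier_vec d. \<forall>n\<in>N. \<rho> n *\<^sub>v w = w}"
  have "invariant_subspace G d \<rho> W"
    unfolding invariant_subspace_def
  proof (intro conjI ballI allI)
    show "W \<subseteq> carrier_vec d" by (auto simp: W_def)
    show "0\<^sub>v d \<in> W"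
      using dim[OF mem_carrier] by (fastforce simp: W_def)
    show "u + w \<in> W" if "u \<in> W" "w \<in> W" for u w
      using that dim[OF mem_carrier] by (auto simp: W_def mult_add_distrib_mat_vec[of _ d d])
    show "c \<cdot>\<^sub>v w \<in> W" if "w \<in> W" for c w
      using that dim[OF mem_carrier] by (auto simp: W_def mult_mat_vec[of _ d d])
    show "\<rho> g *\<^sub>v w \<in> W" if g: "g \<in> carrier G" and w: "w \<in> W" for g w
    proof -
      \<comment> \<open>Normality allows \<open>n\<close> to be moved past \<open>g\<close> at the
        cost of replacing it by a conjugate in \<open>N\<close>, which fixes
        \<open>w\<close>.\<close>
      have "\<rho> n *\<^sub>v (\<rho> g *\<^sub>v w) = \<rho> g *\<^sub>v w" if n: "n \<in> N" for n
      proof -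
        let ?n = "inv g \<otimes> n \<otimes> g"
        have n': "?n \<in> N" using inv_op_closed1[OF g n] .
        have wd: "w \<in> carrier_vec d" using w by (simp add: W_def)
        have "\<rho> n *\<^sub>v (\<rho> g *\<^sub>v w) = \<rho> (n \<otimes> g) *\<^sub>v w"
          using g n dim wd by (simp add: mul assoc_mult_mat_vec[of _ d d _ d])
        also have "n \<otimes> g = g \<otimes> ?n" using g n by (simp flip: m_assoc)
        also have "\<rho> (g \<otimes> ?n) *\<^sub>v w = \<rho> g *\<^sub>v (\<rho> ?n *\<^sub>v w)"
          using assoc_mult_mat_vec[OF dim[OF g] dim[OF mem_carrier[OF n']] wd]
          by (simp add: mul[OF g mem_carrier[OF n']])
        also have "\<rho> ?n *\<^sub>v w = w" using w n' by (simp add: W_def)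
        finally show ?thesis .
      qed
      then show ?thesis using w dim[OF g] by (auto simp: W_def)
    qed
  qed
  then have cases: "W = {0\<^sub>v d} \<or> W = carrier_vec d"
    using irr by (auto simp: irreducible_rep_def)
  have "W \<noteq> {0\<^sub>v d}"
  proof
    assume W0: "W = {0\<^sub>v d}"
    define P where "P = mat d d (\<lambda>ij. \<Sum>n\<in>N. \<rho> n $$ ij)"
    have fixP: "\<rho> m * P = P" if m: "m \<in> N" for m
    proof (rule eq_matI)
      fix i j assume "i < dim_row P" "j < dim_col P"
      then have ij: "i < d" "j < d" by (auto simp: P_def)
      have "(\<rho> m * P) $$ (i,j) = (\<Sum>k<d. \<rho> m $$ (i,k) * (\<Sum>n\<in>N. \<rho> n $$ (k,j)))"
        using ij dim[OF mem_carrier[OF m]] by (simp add: P_def scalar_prod_def atLeast0LessThan)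
      also have "\<dots> = (\<Sum>n\<in>N. \<Sum>k<d. \<rho> m $$ (i,k) * \<rho> n $$ (k,j))"
        unfolding sum_distrib_left by (rule sum.swap)
      also have "\<dots> = (\<Sum>n\<in>N. \<rho> (m \<otimes> n) $$ (i,j))"
      proof (rule sum.cong[OF refl])
        fix n assume n: "n \<in> N"
        show "(\<Sum>k<d. \<rho> m $$ (i,k) * \<rho> n $$ (k,j)) = \<rho> (m \<otimes> n) $$ (i,j)"
          using ij dim[OF mem_carrier[OF m]] dim[OF mem_carrier[OF n]] m n
          by (simp add: mul scalar_prod_def atLeast0LessThan)
      qed
      \<comment> \<open>Left multiplication by \<open>m\<close> permutes \<open>N\<close>.\<close>
      also have "\<dots> = (\<Sum>n\<in>N. \<rho> n $$ (i,j))"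
        by (rule sum.reindex_bij_witness[of _ "\<lambda>n. inv m \<otimes> n" "\<lambda>n. m \<otimes> n"])
          (use m in \<open>auto simp flip: m_assoc\<close>)
      finally show "(\<rho> m * P) $$ (i,j) = P $$ (i,j)" using ij by (simp add: P_def)
    qed (use dim[OF mem_carrier[OF m]] in \<open>auto simp: P_def\<close>)
    have P: "P \<in> carrier_mat d d" by (simp add: P_def)
    have colW: "col P j \<in> W" if j: "j < d" for j
      unfolding W_def using fixP P j dim[OF mem_carrier]
      by (auto simp flip: col_mult2[OF dim[OF mem_carrier] P j])
    have "P $$ (j,j) = 0" if j: "j < d" for j
    proof -
      have "col P j = 0\<^sub>v d" using colW[OF j] W0 by simp
      then have "col P j $ j = 0" using j by simp
      then show ?thesis using j P by simp
    qed
    then have "0 = (\<Sum>j<d. P $$ (j,j))" by simp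
    also have "\<dots> = (\<Sum>n\<in>N. \<Sum>j<d. \<rho> n $$ (j,j))"
      by (simp add: P_def) (rule sum.swap)
    also have "\<dots> = (\<Sum>n\<in>N. rep_char G \<rho> n)"
      by (rule sum.cong) (use dim[OF mem_carrier] in \<open>auto simp: rep_char_def carrier_matD\<close>)
    \<comment> \<open>The kernel hypothesis enters here: every element of \<open>N\<close> has the
      same trace as the identity.\<close>
    also have "\<dots> = (\<Sum>n\<in>N. of_nat d)"
      using ker char_one[OF is_group rep] by (intro sum.cong) (auto simp: char_ker_def)
    finally show False using d card_N_pos by simp
  qed
  then show ?thesis using cases n w by (auto simp: W_def)
qed

text \<open>The kernel condition only concerns character values; it is first lifted to the
  representation, where \<open>\<rho> n\<close> fixes every column of
  \<open>\<rho> g\<close>.\<close>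

lemma Irr_const_on_cosets:
  assumes \<chi>: "\<chi> \<in> Irr G" and ker: "N \<subseteq> char_ker G \<chi>" and n: "n \<in> N" and g: "g \<in> carrier G"
  shows "\<chi> (n \<otimes> g) = \<chi> g"
proof -
  obtain d \<rho> where irr: "irreducible_rep G d \<rho>" and \<chi>: "\<chi> = rep_char G \<rho>"
    using \<chi> by (auto simp: Irr_def)
  have dim: "\<rho> g \<in> carrier_mat d d" "\<rho> n \<in> carrier_mat d d" and mul: "\<rho> (n \<otimes> g) = \<rho> n * \<rho> g"
    using irr g n by (auto simp: irreducible_rep_def is_rep_def)
  have "\<rho> n * \<rho> g = \<rho> g"
  proof (rule mat_col_eqI)
    fix j assume "j < dim_col (\<rho> g)"
    then have j: "j < d" using dim by simp
    then show "col (\<rho> n * \<rho> g) j = col (\<rho> g) j"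
      using irreducible_rep_fixes[OF irr ker[unfolded \<chi>] n, of "col (\<rho> g) j"] dim
      by (simp add: col_mult2[OF dim(2,1) j])
  qed (use dim in auto)
  then show ?thesis using n g by (simp add: \<chi> rep_char_def mul)
qed

end


section \<open>The quotient supercharacter theory\<close>

locale quotient_setup = finite_normal N G for N and G (structure) +
  fixes C :: "'a schar_theory"
  assumes fin_Irr: "finite (Irr G)" and part: "partition_on (Irr G) (fst C)"
begin

abbreviation "C' \<equiv> quotient_theory G C N"

text \<open>The parts \<open>X_1, ..., X_p\<close> without their numbering, which enters only in the
  final theorem.\<close>

definition XN where "XN = {X \<in> fst C. in_Irr_quotient G N X}"

lemma in_Irr: "X \<in> fst C \<Longrightarrow> \<chi> \<in> X \<Longrightarrow> \<chi> \<in> Irr G"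
  using part by (auto simp: partition_on_def)

lemma fin_C: "finite (fst C)"
  using finite_elements[OF fin_Irr part] .

text \<open>With inflation as a left inverse, deflation is injective on each part and, through
  images, on the set of parts. This justifies the reindexing of sums and products below.\<close>

lemma inflate_deflate_XN:
  assumes "X \<in> XN" "\<chi> \<in> X"
  shows "inflate G N (deflate G N \<chi>) = \<chi>"
proof -
  have "\<chi> \<in> Irr G" "N \<subseteq> char_ker G \<chi>"
    using assms in_Irr by (auto simp: XN_def in_Irr_quotient_def)
  then show ?thesis by (intro inflate_deflate Irr_const_on_cosets Irr_outside)
qed

lemma inflate_image_XN: "X \<in> XN \<Longrightarrow> inflate G N ` deflate G N ` X = X"
  by (auto simp: image_image inflate_deflate_XN)

lemma inj_on_deflate: "X \<in> XN \<Longrightarrow> inj_on (deflate G N) X"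
  by (rule inj_on_inverseI[of _ "inflate G N"]) (rule inflate_deflate_XN)

lemma inj_on_image_deflate: "inj_on ((`) (deflate G N)) XN"
  by (rule inj_on_inverseI[of _ "(`) (inflate G N)"]) (rule inflate_image_XN)

lemma fst_quotient_theory: "fst C' = (`) (deflate G N) ` XN"
  by (auto simp: quotient_theory_def XN_def)

lemma deflate_one:
  assumes "X \<in> XN" "\<chi> \<in> X"
  shows "deflate G N \<chi> N = \<chi> \<one>"
  using fun_cong[OF inflate_deflate_XN[OF assms], of \<one>] coset_mult_one[OF subset]
  by (simp add: inflate_def one_Mod)

text \<open>Composing \<open>v\<close> with inflation gives a deflated character the variable of its
  inflation, and deflation preserves the degree.\<close>

lemma char_monomial_deflate:
  assumes "X \<in> XN"
  shows "char_monomial (G Mod N) (v \<circ> inflate G N) (deflate G N ` X) = char_monomial G v X"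
  unfolding char_monomial_def prod.reindex[OF inj_on_deflate[OF assms]]
  by (rule prod.cong)
    (simp_all add: inflate_deflate_XN[OF assms] char_degree_def deflate_one[OF assms])

lemma inflate_supercharacter:
  assumes "X \<in> XN"
  shows "inflate G N (supercharacter (G Mod N) (deflate G N ` X)) = supercharacter G X"
proof
  fix g
  show "inflate G N (supercharacter (G Mod N) (deflate G N ` X)) g = supercharacter G X g"
  proof (cases "g \<in> carrier G")
    case True
    have "deflate G N \<chi> (N #> g) = \<chi> g" if "\<chi> \<in> X" for \<chi>
      using fun_cong[OF inflate_deflate_XN[OF assms that], of g] True by (simp add: inflate_def)
    then show ?thesis using True
      by (simp add: inflate_def supercharacter_def sum.reindex[OF inj_on_deflate[OF assms]]
          deflate_one[OF assms])
  next
    case False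
    then show ?thesis
      using assms in_Irr Irr_outside[OF _ False]
      by (auto simp: inflate_def supercharacter_def XN_def intro!: sum.neutral)
  qed
qed

text \<open>The two hypotheses, repeated in the next lemmas, say that \<open>a\<close> is
  \<open>b\<close> transported along inflation and extended by zero.\<close>

lemma inflate_supercharacter_comb:
  assumes "\<And>X. X \<in> XN \<Longrightarrow> a X = b (deflate G N ` X)" "\<And>X. X \<in> fst C - XN \<Longrightarrow> a X = 0"
  shows "inflate G N (supercharacter_comb (G Mod N) C' b) = supercharacter_comb G C a"
proof
  fix g
  have "supercharacter_comb G C a g = (\<Sum>X\<in>XN. of_nat (a X) * supercharacter G X g)"
    unfolding supercharacter_comb_def using assms(2) fin_C
    by (intro sum.mono_neutral_right) (auto simp: XN_def)
  also have "\<dots> = (\<Sum>X\<in>XN. of_nat (b (deflate G N ` X)) *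
      inflate G N (supercharacter (G Mod N) (deflate G N ` X)) g)"
    by (rule sum.cong) (simp_all add: assms(1) inflate_supercharacter)
  also have "\<dots> = inflate G N (supercharacter_comb (G Mod N) C' b) g"
    by (simp add: inflate_def supercharacter_comb_def fst_quotient_theory
        sum.reindex[OF inj_on_image_deflate])
  finally show "inflate G N (supercharacter_comb (G Mod N) C' b) g = supercharacter_comb G C a g" ..
qed

text \<open>Both combinations lie in \<open>super_Ch\<close> by construction, so only the monomial
  monoids have to be compared.\<close>

lemma supercharacter_comb_monomial_iff:
  assumes "\<And>X. X \<in> XN \<Longrightarrow> a X = b (deflate G N ` X)" "\<And>X. X \<in> fst C - XN \<Longrightarrow> a X = 0"
  shows "supercharacter_comb (G Mod N) C' b \<in> monomial_supermonoid (G Mod N) C' \<longleftrightarrow>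
         supercharacter_comb G C a \<in> monomial_supermonoid G C"
proof -
  have "supercharacter (G Mod N) Y A = 0" if "A \<notin> carrier (G Mod N)" "Y \<in> fst C'" for A Y
    using that by (auto simp: supercharacter_def fst_quotient_theory deflate_def intro!: sum.neutral)
  then have "supercharacter_comb (G Mod N) C' b A = 0" if "A \<notin> carrier (G Mod N)" for A
    using that by (simp add: supercharacter_comb_def)
  then show ?thesis
    using inflate_monomial_monoid_iff[of "supercharacter_comb (G Mod N) C' b"]
      inflate_supercharacter_comb[of a b, OF assms]
    by (simp add: monomial_supermonoid_def super_Ch_def)
qed

lemma prod_char_monomial_quotient:
  fixes v :: "('a \<Rightarrow> complex) \<Rightarrow> 'v"
  assumes "\<And>X. X \<in> XN \<Longrightarrow> a X = b (deflate G N ` X)" "\<And>X. X \<in> fst C - XN \<Longrightarrow> a X = 0"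
  shows "(\<Prod>Y\<in>fst C'. char_monomial (G Mod N) (v \<circ> inflate G N) Y ^ b Y) =
         (\<Prod>X\<in>fst C. char_monomial G v X ^ a X :: ('v, 'k::field) mpol)"
proof -
  have "(\<Prod>X\<in>fst C. char_monomial G v X ^ a X :: ('v, 'k) mpol) = (\<Prod>X\<in>XN. char_monomial G v X ^ a X)"
    using assms(2) fin_C by (intro prod.mono_neutral_right) (auto simp: XN_def)
  also have "\<dots> = (\<Prod>X\<in>XN. char_monomial (G Mod N) (v \<circ> inflate G N) (deflate G N ` X)
      ^ b (deflate G N ` X))"
    by (rule prod.cong) (simp_all add: assms(1) char_monomial_deflate)
  finally show ?thesis
    by (simp add: fst_quotient_theory prod.reindex[OF inj_on_image_deflate])
qed

lemma monomial_algebra_quotient: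
  fixes v :: "('a \<Rightarrow> complex) \<Rightarrow> 'v"
  shows "(monomial_algebra (G Mod N) (v \<circ> inflate G N) C' :: ('v, 'k::field) mpol set) =
     mpol_span {\<Prod>X\<in>fst C. char_monomial G v X ^ a X | a.
       (\<forall>X\<in>fst C - XN. a X = 0) \<and> supercharacter_comb G C a \<in> monomial_supermonoid G C}"
  (is "_ = mpol_span ?R")
proof -
  let ?L = "{\<Prod>Y\<in>fst C'. char_monomial (G Mod N) (v \<circ> inflate G N) Y ^ b Y | b.
       supercharacter_comb (G Mod N) C' b \<in> monomial_supermonoid (G Mod N) C'} :: ('v, 'k) mpol set"
  have "?L = ?R"
  proof (intro equalityI subsetI)
    fix q assume "q \<in> ?L"
    then obtain b where b: "q = (\<Prod>Y\<in>fst C'. char_monomial (G Mod N) (v \<circ> inflate G N) Y ^ b Y)"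
       "supercharacter_comb (G Mod N) C' b \<in> monomial_supermonoid (G Mod N) C'" by blast
    \<comment> \<open>Extension by zero to the parts that do not come from the quotient.\<close>
    define a where "a X = (if X \<in> XN then b (deflate G N ` X) else 0)" for X
    have a: "\<And>X. X \<in> XN \<Longrightarrow> a X = b (deflate G N ` X)" "\<And>X. X \<in> fst C - XN \<Longrightarrow> a X = 0"
      by (auto simp: a_def)
    show "q \<in> ?R"
      using b prod_char_monomial_quotient[of a b, OF a] supercharacter_comb_monomial_iff[of a b, OF a] a(2)
      by blast
  next
    fix q assume "q \<in> ?R"
    then obtain a where a: "q = (\<Prod>X\<in>fst C. char_monomial G v X ^ a X)"
       "\<And>X. X \<in> fst C - XN \<Longrightarrow> a X = 0" "supercharacter_comb G C a \<in> monomial_supermonoid G C"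
      by blast
    \<comment> \<open>The exponent of a deflated part is read off at its inflation, which is the
      original part.\<close>
    define b where "b Y = a (inflate G N ` Y)" for Y
    have b: "\<And>X. X \<in> XN \<Longrightarrow> a X = b (deflate G N ` X)"
      by (simp only: b_def inflate_image_XN)
    have "q = (\<Prod>Y\<in>fst C'. char_monomial (G Mod N) (v \<circ> inflate G N) Y ^ b Y)"
      unfolding a(1) by (rule prod_char_monomial_quotient[symmetric]) (use a(2) b in auto)
    moreover have "supercharacter_comb (G Mod N) C' b \<in> monomial_supermonoid (G Mod N) C'"
      by (rule iffD2[OF supercharacter_comb_monomial_iff a(3)]) (use a(2) b in auto)
    ultimately show "q \<in> ?L" by blast
  qed
  then show ?thesis by (simp add: monomial_algebra_def)
qed

end

section \<open>Exponent vectors and the intersection of the algebras\<close>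

definition char_exponent ::
  "('a, 'b) monoid_scheme \<Rightarrow> (('a \<Rightarrow> complex) \<Rightarrow> 'v) \<Rightarrow> ('a \<Rightarrow> complex) set \<Rightarrow> 'v \<Rightarrow>\<^sub>0 nat" where
  "char_exponent G v X = (\<Sum>\<chi>\<in>X. Poly_Mapping.single (v \<chi>) (char_degree G \<chi>))"

lemma char_monomial_eq_single:
  "(char_monomial G v X :: ('v, 'k::field) mpol) = Poly_Mapping.single (char_exponent G v X) 1"
proof -
  have "mpol_var i ^ n = (Poly_Mapping.single (Poly_Mapping.single i n) 1 :: ('v, 'k) mpol)" for i n
    by (induction n) (simp_all add: mpol_var_def mult_single flip: single_add)
  then show ?thesis by (simp add: char_monomial_def char_exponent_def prod_single)
qed

theorem theorem3p6:
  fixes G :: "('a, 'b) monoid_scheme"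
    and C :: "'a schar_theory"
    and N :: "'a set"
    and chi :: "nat \<Rightarrow> 'a \<Rightarrow> complex"
    and X :: "nat \<Rightarrow> ('a \<Rightarrow> complex) set"
    and r m p :: nat
  defines "v \<equiv> inv_into {1..r} chi"
  assumes "group G" and "finite (carrier G)"
    and "bij_betw chi {1..r} (Irr G)"
    and "supercharacter_theory G C"
    and "C_normal G C N"
    and "bij_betw X {1..m} (fst C)"
    and "p \<le> m"
    and "\<forall>i\<in>{1..p}. in_Irr_quotient G N (X i)"
    and "\<forall>i\<in>{p+1..m}. \<not> in_Irr_quotient G N (X i)"
  shows "(monomial_algebra (G Mod N) (v \<circ> inflate G N) (quotient_theory G C N)
            :: (nat, 'k::field) mpol set) =
         monomial_algebra G v C \<inter> generated_subalgebra ((\<lambda>i. char_monomial G v (X i)) ` {1..p})"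
proof -
  have part: "partition_on (Irr G) (fst C)"
    using assms(5) by (auto simp: supercharacter_theory_def)
  interpret normal N G using assms(6) by (simp add: C_normal_def)
  interpret quotient_setup N G C
    using assms(3) bij_betw_finite[OF assms(4)] part by unfold_locales auto
  \<comment> \<open>Distinct irreducible characters get distinct variables, since \<open>v\<close>
    inverts the numbering.\<close>
  have inj_v: "inj_on v (Irr G)"
    using bij_betw_inv_into[OF assms(4)] by (simp add: v_def bij_betw_def)
  have XN: "XN = X ` {1..p}"
  proof -
    have "{1..m} = {1..p} \<union> {p+1..m}" using assms(8) by auto
    then have "fst C = X ` {1..p} \<union> X ` {p+1..m}"
      using bij_betw_imp_surj_on[OF assms(7)] by (metis image_Un)
    then show ?thesis using assms(9,10) by (auto simp: XN_def)
  qed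
  let ?S = "(\<lambda>i. char_monomial G v (X i)) ` {1..p} :: (nat, 'k) mpol set"
  \<comment> \<open>The exponent vector of the monomial \<open>F^a\<close>.\<close>
  define e where "e a = (\<Sum>Y\<in>fst C. \<Sum>i<a Y. char_exponent G v Y)"
    for a :: "('a \<Rightarrow> complex) set \<Rightarrow> nat"
  have mono: "(\<Prod>Y\<in>fst C. char_monomial G v Y ^ a Y) = (Poly_Mapping.single (e a) 1 :: (nat, 'k) mpol)" for a
    by (simp add: e_def char_monomial_eq_single single_power prod_single)
  let ?A = "{a. supercharacter_comb G C a \<in> monomial_supermonoid G C}"
  \<comment> \<open>Both algebras become spans of monomials, over \<open>e\<close>
    ?A\<open>and\<close>e \<open>?B\<close>; what remains is to compare supports.\<close>
  let ?B = "{a \<in> ?A. \<forall>Y\<in>fst C - XN. a Y = 0}"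
  have alg: "monomial_algebra G v C = mpol_span ((\<lambda>e. Poly_Mapping.single e (1::'k)) ` e ` ?A)"
    unfolding monomial_algebra_def mono by (simp add: setcompr_eq_image image_image)
  have alg': "monomial_algebra (G Mod N) (v \<circ> inflate G N) C' =
      mpol_span ((\<lambda>e. Poly_Mapping.single e (1::'k)) ` e ` ?B)"
    unfolding monomial_algebra_quotient mono by (simp add: setcompr_eq_image image_image conj_commute)
  show ?thesis
  proof (intro equalityI subsetI IntI)
    fix q :: "(nat, 'k) mpol"
    assume q: "q \<in> monomial_algebra (G Mod N) (v \<circ> inflate G N) C'"
    then show "q \<in> monomial_algebra G v C"
      unfolding alg alg' using mpol.span_mono[OF image_mono[OF image_mono[of ?B ?A]]] by blast
    have "Poly_Mapping.single (e a) (1::'k) \<in> generated_subalgebra ?S" if a: "a \<in> ?B" for a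
    proof -
      have "char_monomial G v Y ^ a Y \<in> generated_subalgebra ?S" if "Y \<in> fst C" for Y
      proof (cases "Y \<in> XN")
        case True
        then show ?thesis
          by (intro generated_subalgebra_power generated_subalgebra.gen[of _ ?S]) (auto simp: XN)
      next
        case False
        then have "a Y = 0" using a that by blast
        then show ?thesis using generated_subalgebra.const[of 1 ?S] by (simp add: mpol_const_def)
      qed
      then show ?thesis unfolding mono[symmetric] by (rule generated_subalgebra_prod)
    qed
    then have "mpol_span ((\<lambda>e. Poly_Mapping.single e (1::'k)) ` e ` ?B) \<subseteq> generated_subalgebra ?S"
      by (intro mpol.span_minimal subspace_generated_subalgebra) auto
    then show "q \<in> generated_subalgebra ?S" using q unfolding alg' by blast
  next
    fix q :: "(nat, 'k) mpol"
    assume "q \<in> monomial_algebra G v C \<inter> generated_subalgebra ?S"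
    then have q1: "Poly_Mapping.keys q \<subseteq> e ` ?A" and q2: "q \<in> generated_subalgebra ?S"
      unfolding alg using keys_mpol_span by blast+
    \<comment> \<open>Exponents free of the variables of parts outside \<open>XN\<close>. They form
      a monoid, and it contains the exponents of \<open>F_1, ..., F_p\<close> because the parts are
      disjoint and \<open>v\<close> is injective.\<close>
    define M where "M = {d :: nat \<Rightarrow>\<^sub>0 nat. \<forall>Y\<in>fst C - XN. \<forall>\<chi>\<in>Y. Poly_Mapping.lookup d (v \<chi>) = 0}"
    have "Poly_Mapping.keys q \<subseteq> M"
      using q2
    proof (rule keys_generated_subalgebra)
      fix f :: "(nat, 'k) mpol" assume "f \<in> ?S"
      then obtain Y where Y: "Y \<in> XN" "f = char_monomial G v Y" by (auto simp: XN)
      have "Poly_Mapping.lookup (char_exponent G v Y) (v \<chi>) = 0" if Z: "Z \<in> fst C - XN" "\<chi> \<in> Z" for Z \<chi>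
      proof -
        have "v \<psi> \<noteq> v \<chi>" if "\<psi> \<in> Y" for \<psi>
        proof
          assume "v \<psi> = v \<chi>"
          then have "\<psi> = \<chi>"
            using inj_onD[OF inj_v] in_Irr Y Z that by (auto simp: XN_def)
          then have "Y = Z"
            using Y Z that partition_onD2[OF part] by (auto simp: XN_def disjoint_def)
          then show False using Y Z by blast
        qed
        then show ?thesis
          by (simp add: char_exponent_def lookup_sum lookup_single)
      qed
      then show "Poly_Mapping.keys f \<subseteq> M" by (simp add: Y char_monomial_eq_single M_def)
    qed (auto simp: M_def lookup_add)
    have "Poly_Mapping.keys q \<subseteq> e ` ?B"
    proof
      fix d assume d: "d \<in> Poly_Mapping.keys q"
      then obtain a where a: "a \<in> ?A" "d = e a" using q1 by blast
      \<comment> \<open>A part is nonempty and degrees are positive, so some variable occurs in the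
        monomial of \<open>Y\<close>. As the coordinates of \<open>e a\<close> are sums of natural
        numbers, its absence forces \<open>a Y = 0\<close>, so the given \<open>a\<close> itself
        lies in \<open>?B\<close>.\<close>
      have "a Y = 0" if Y: "Y \<in> fst C - XN" for Y
      proof -
        have "Y \<noteq> {}" using Y partition_onD3[OF part] by auto
        then obtain \<chi> where \<chi>: "\<chi> \<in> Y" by blast
        have "Poly_Mapping.lookup (e a) (v \<chi>) = 0" using d a \<open>Poly_Mapping.keys q \<subseteq> M\<close> Y \<chi> by (auto simp: M_def)
        then have "a Y = 0 \<or> Poly_Mapping.lookup (char_exponent G v Y) (v \<chi>) = 0"
          using Y fin_C unfolding e_def lookup_sum by auto
        moreover have "finite Y"
          using Y in_Irr fin_Irr by (auto intro: finite_subset)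
        then have "Poly_Mapping.lookup (char_exponent G v Y) (v \<chi>) \<ge> char_degree G \<chi>"
          using member_le_sum[of \<chi> Y "\<lambda>\<psi>. Poly_Mapping.lookup (Poly_Mapping.single (v \<psi>) (char_degree G \<psi>)) (v \<chi>)"] \<chi>
          by (simp add: char_exponent_def lookup_sum)
        moreover have "char_degree G \<chi> > 0"
          using char_degree_pos[OF is_group] in_Irr Y \<chi> by blast
        ultimately show ?thesis by linarith
      qed
      then show "d \<in> e ` ?B" using a by blast
    qed
    then show "q \<in> monomial_algebra (G Mod N) (v \<circ> inflate G N) C'"
      unfolding alg' by (rule mpol_span_if_keys)
  qed
qed

end
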